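(* Let $F:\mathbb{R}^n\to\mathbb{R}^n$ be continuously differentiable, $G:\mathbb{R}^n\to\mathbb{R}^s$ twice continuously differentiable, and $D\subseteq\mathbb{R}^s$ a convex polyhedral set. Suppose that $\bar x$ solves $0\in F(x)+\nabla G(x)N_D(G(x))$ and that $(\bar x,G(\bar x))$ is nondegenerate with some modulus $\tilde\gamma>0$; let $\bar\lambda$ be the unique multiplier at $\bar x$. Then the following two conditions are equivalent: (i) for any face $\mathcal F$ of the critical cone $\mathcal K_D(G(\bar x),\bar\lambda)$ there is a matrix $Z_{\mathcal F}$, whose columns form an orthogonal basis of $\{u\mid G'(\bar x)u\in\operatorname{span}\mathcal F\}$, such that the matrix $Z_{\mathcal F}^\top\mathcal L'_{\bar\lambda}(\bar x)Z_{\mathcal F}$ is nonsingular; (ii) every element of $\mathcal T_S(\bar x)$ is nonsingular.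
   Context: $G'(x)$ is the Jacobian and $\nabla G(x)=G'(x)^\top$ its adjoint; $N_D$, $T_D$ are the normal and tangent cones of convex analysis. $\mathcal L_\lambda(x):=F(x)+\nabla G(x)\lambda$, and $\mathcal L'_\lambda(x)$ is its derivative in $x$ with $\lambda$ fixed. For $d\in D$, $\lambda\in N_D(d)$, $\mathcal K_D(d,\lambda):=T_D(d)\cap\{\lambda\}^\perp$. Faces of a polyhedral cone $K$ are the sets $K\cap\{\nu\}^\perp$ with $\nu\in K^\circ$ (polar cone). A pair $(x,d)$ is nondegenerate with modulus $\gamma>0$ if $\|\nabla G(x)\lambda\|\ge\gamma\|\lambda\|$ for all $\lambda\in\operatorname{span}N_D(d)$. Under the nondegeneracy assumption there is a unique $\bar\lambda\in N_D(G(\bar x))$ with $\mathcal L_{\bar\lambda}(\bar x)=0$. For $x$ in a sufficiently small ball around $\bar x$, $S(x)$ is the unique $u$ with $0\in u+F(x)+\nabla G(x)N_D(G(x)+G'(x)u)$, and $\Lambda(x)$ is the unique $\lambda\in N_D(G(x)+G'(x)S(x))$ with $S(x)+F(x)+\nabla G(x)\lambda=0$; in particular $S(\bar x)=0$ and $\Lambda(\bar x)=\bar\lambda$. For such $x$, with $u=S(x)$, $d=G(x)+G'(x)u$, $\lambda=\Lambda(x)$, $\mathcal T_S(x)$ is the set of all matrices $$-\mathcal L_\lambda'(x)+\nabla G(x)W\big[W^\top G'(x)\nabla G(x)W\big]^{-1}W^\top\big(G'(x)\mathcal L_\lambda'(x)-[G(x)+G'(x)u]'_x\big)$$ where $W$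 has full column rank and $\operatorname{range}W=(\operatorname{span}\mathcal F)^\perp$ for some face $\mathcal F$ of $\mathcal K_D(d,\lambda)$; $[\cdot]'_x$ is the derivative in $x$ with $u$ fixed. A $W$ with zero columns contributes a zero second term; the $0\times0$ matrix is regarded as nonsingular. *)

theory Defs
  imports
    "Jordan_Normal_Form.Gauss_Jordan_Elimination"
    "HOL-Analysis.Analysis"
begin

no_notation Matrix.vec_index (infixl "$" 100)

section \<open>Smoothness and derivatives\<close>

definition cont_diff :: "('a::real_normed_vector \<Rightarrow> 'b::real_normed_vector) \<Rightarrow> bool" where
  "cont_diff f \<longleftrightarrow>
     (\<exists>f' :: 'a \<Rightarrow> 'a \<Rightarrow>\<^sub>L 'b. (\<forall>x. (f has_derivative blinfun_apply (f' x)) (at x)) \<and>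
        continuous_on UNIV f')"

definition twice_cont_diff :: "('a::real_normed_vector \<Rightarrow> 'b::real_normed_vector) \<Rightarrow> bool" where
  "twice_cont_diff f \<longleftrightarrow>
     (\<exists>f' :: 'a \<Rightarrow> 'a \<Rightarrow>\<^sub>L 'b. (\<forall>x. (f has_derivative blinfun_apply (f' x)) (at x)) \<and>
        cont_diff f')"

abbreviation Jac :: "(real^'n \<Rightarrow> real^'m) \<Rightarrow> real^'n \<Rightarrow> real^'n^'m" where
  "Jac f x \<equiv> jacobian f (at x)"

abbreviation nabla :: "(real^'n \<Rightarrow> real^'m) \<Rightarrow> real^'n \<Rightarrow> real^'m^'n" where
  "nabla G x \<equiv> transpose (Jac G x)"

definition Lagr :: "(real^'n \<Rightarrow> real^'n) \<Rightarrow> (real^'n \<Rightarrow> real^'s) \<Rightarrow> real^'s \<Rightarrow> real^'n \<Rightarrow> real^'n" where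
  "Lagr F G l x = F x + nabla G x *v l"

section \<open>Cones and faces\<close>

text \<open>Both cones are empty at points outside the set.\<close>

definition normal_cone :: "'a::euclidean_space set \<Rightarrow> 'a \<Rightarrow> 'a set" where
  "normal_cone D d = {v. d \<in> D \<and> (\<forall>y\<in>D. v \<bullet> (y - d) \<le> 0)}"

definition tangent_cone :: "'a::euclidean_space set \<Rightarrow> 'a \<Rightarrow> 'a set" where
  "tangent_cone D d = (if d \<in> D then closure (conic hull ((\<lambda>y. y - d) ` D)) else {})"

definition critical_cone :: "'a::euclidean_space set \<Rightarrow> 'a \<Rightarrow> 'a \<Rightarrow> 'a set" where
  "critical_cone D d l = tangent_cone D d \<inter> {l}\<^sup>\<bottom>"

definition polar_cone :: "'a::euclidean_space set \<Rightarrow> 'a set" where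
  "polar_cone K = {v. \<forall>y\<in>K. v \<bullet> y \<le> 0}"

text \<open>Unlike for the library's \<open>face_of\<close>, the empty set is not a face of a nonempty cone.\<close>

definition cone_face :: "'a::euclidean_space set \<Rightarrow> 'a set \<Rightarrow> bool" where
  "cone_face A K \<longleftrightarrow> (\<exists>v\<in>polar_cone K. A = K \<inter> {v}\<^sup>\<bottom>)"

definition nondegenerate ::
  "(real^'n \<Rightarrow> real^'s) \<Rightarrow> (real^'s) set \<Rightarrow> real^'n \<Rightarrow> real^'s \<Rightarrow> real \<Rightarrow> bool" where
  "nondegenerate G D x d \<gamma> \<longleftrightarrow>
     0 < \<gamma> \<and> (\<forall>l\<in>span (normal_cone D d). norm (nabla G x *v l) \<ge> \<gamma> * norm l)"

section \<open>Matrices with a variable number of columns\<close>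

text \<open>A matrix \<open>W\<close> with \<open>k\<close> columns, where \<open>k\<close> may vary and may be \<open>0\<close>, is represented by the
  list \<open>ws\<close> of its columns. Then \<open>span (set ws)\<close> is the range of \<open>W\<close>, and
  \<open>W\<^sup>T A W\<close> and \<open>W C W\<^sup>T\<close> are as follows; the former is a \<open>k \<times> k\<close> matrix with \<open>k\<close> a
  natural number. For \<open>k = 0\<close> it is invertible, and the latter is then the zero matrix.\<close>

definition full_column_rank :: "(real^'m) list \<Rightarrow> bool" where
  "full_column_rank ws \<longleftrightarrow> distinct ws \<and> independent (set ws)"

definition orthogonal_basis :: "(real^'m) list \<Rightarrow> (real^'m) set \<Rightarrow> bool" where
  "orthogonal_basis zs V \<longleftrightarrow>
     distinct zs \<and> pairwise orthogonal (set zs) \<and> independent (set zs) \<and> span (set zs) = V"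

definition compress :: "(real^'m) list \<Rightarrow> real^'m^'m \<Rightarrow> real mat" where
  "compress ws A = Matrix.mat (length ws) (length ws) (\<lambda>(i, j). (ws ! i) \<bullet> (A *v (ws ! j)))"

definition expand :: "(real^'m) list \<Rightarrow> real mat \<Rightarrow> real^'m^'m" where
  "expand ws C =
     (\<chi> p q. \<Sum>i<length ws. \<Sum>j<length ws. (ws ! i) $ p * C $$ (i, j) * (ws ! j) $ q)"

section \<open>The solution map, the multiplier map and the generalized derivative\<close>

definition S_map ::
  "(real^'n \<Rightarrow> real^'n) \<Rightarrow> (real^'n \<Rightarrow> real^'s) \<Rightarrow> (real^'s) set \<Rightarrow> real^'n \<Rightarrow> real^'n" where
  "S_map F G D x =
     (THE u. 0 \<in> (\<lambda>l. u + F x + nabla G x *v l) ` normal_cone D (G x + Jac G x *v u))"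

definition Lambda_map ::
  "(real^'n \<Rightarrow> real^'n) \<Rightarrow> (real^'n \<Rightarrow> real^'s) \<Rightarrow> (real^'s) set \<Rightarrow> real^'n \<Rightarrow> real^'s" where
  "Lambda_map F G D x =
     (THE l. l \<in> normal_cone D (G x + Jac G x *v S_map F G D x) \<and>
        S_map F G D x + F x + nabla G x *v l = 0)"

text \<open>The inverse below exists whenever \<open>x\<close> is close to a nondegenerate solution: the range of
  \<open>W\<close> is then contained in \<open>span (normal_cone D d)\<close>, on which \<open>nabla G x\<close> is injective.\<close>

definition T_S ::
  "(real^'n \<Rightarrow> real^'n) \<Rightarrow> (real^'n \<Rightarrow> real^'s) \<Rightarrow> (real^'s) set \<Rightarrow> real^'n \<Rightarrow> (real^'n^'n) set" where
  "T_S F G D x =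
     (let u = S_map F G D x;
          d = G x + Jac G x *v u;
          l = Lambda_map F G D x;
          L' = Jac (Lagr F G l) x
      in {- L' + nabla G x **
               expand ws (the (mat_inverse (compress ws (Jac G x ** nabla G x)))) **
               (Jac G x ** L' - Jac (\<lambda>y. G y + Jac G y *v u) x) | ws.
            full_column_rank ws \<and>
            (\<exists>A. cone_face A (critical_cone D d l) \<and> span (set ws) = (span A)\<^sup>\<bottom>)})"

end

theory Submission
  imports Defs "Jordan_Normal_Form.Determinant"
begin

no_notation scalar_prod (infix "\<bullet>" 70)

text \<open>Write \<open>B\<close> for the Jacobian of \<open>G\<close> and \<open>L\<close> for that of the Lagrangian, both at the solution. For a
  face \<open>A\<close> of the critical cone let \<open>V\<close> be the preimage of \<open>span A\<close> under \<open>B\<close>. Both conditions say,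
  face by face, that the bilinear form \<open>(z, u) \<mapsto> z \<bullet> L u\<close> is nondegenerate on \<open>V\<close>.
  For the first condition this is immediate. For the second, monotonicity of the normal cone gives
  \<open>S = 0\<close> at the solution, so an element of \<open>T_S\<close> is \<open>M = - L + B\<^sup>T E (B L - B)\<close>
  with \<open>E = W (W\<^sup>T B B\<^sup>T W)\<^sup>-\<^sup>1 W\<^sup>T\<close>. Testing \<open>M u\<close> against \<open>B\<^sup>T w\<close> for \<open>w\<close> in the range of \<open>W\<close>
  gives \<open>- w \<bullet> B u\<close>, and testing it against \<open>z \<in> V\<close> gives \<open>- z \<bullet> L u\<close> once \<open>u \<in> V\<close>; these tests
  detect whether \<open>M u = 0\<close>, as \<open>V\<close> is the orthogonal complement of the vectors \<open>B\<^sup>T w\<close>.\<close>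

section \<open>Compressed and expanded matrices\<close>

lemma span_set_nth:
  fixes ws :: "'a::real_vector list"
  assumes "distinct ws"
  shows "span (set ws) = range (\<lambda>c. \<Sum>i<length ws. c i *\<^sub>R ws ! i)"
proof (intro equalityI subsetI)
  fix x assume "x \<in> span (set ws)"
  then obtain c where "x = (\<Sum>b\<in>set ws. c b *\<^sub>R b)"
    by (auto simp: span_finite)
  also have "\<dots> = (\<Sum>i<length ws. c (ws ! i) *\<^sub>R ws ! i)"
    using sum.reindex_bij_betw[OF bij_betw_nth[OF assms refl refl], of "\<lambda>b. c b *\<^sub>R b"] by simp
  finally show "x \<in> range (\<lambda>c. \<Sum>i<length ws. c i *\<^sub>R ws ! i)"
    by (auto intro!: image_eqI[of _ _ "\<lambda>i. c (ws ! i)"])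
qed (auto intro!: span_sum span_scale intro: span_base)

lemma independent_nth_coeff_zero:
  fixes ws :: "'a::real_vector list"
  assumes "distinct ws" "independent (set ws)"
    and sum0: "(\<Sum>i<length ws. c i *\<^sub>R ws ! i) = 0" and "i < length ws"
  shows "c i = 0"
proof -
  \<comment> \<open>Coefficients indexed by position become a function of the vector, well defined
    because the columns are distinct.\<close>
  let ?g = "\<lambda>b. c (the_inv_into {..<length ws} ((!) ws) b)"
  have bij: "bij_betw ((!) ws) {..<length ws} (set ws)"
    using bij_betw_nth[OF assms(1) refl refl] .
  have g: "?g (ws ! j) = c j" if "j < length ws" for j
    using that bij by (simp add: bij_betw_def the_inv_into_f_f)
  have "(\<Sum>b\<in>set ws. ?g b *\<^sub>R b) = (\<Sum>j<length ws. ?g (ws ! j) *\<^sub>R ws ! j)"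
    using sum.reindex_bij_betw[OF bij, of "\<lambda>b. ?g b *\<^sub>R b"] by simp
  also have "\<dots> = 0"
    using sum0 g by simp
  finally have "?g (ws ! i) = 0"
    using independentD[OF assms(2) finite_set subset_refl, of ?g "ws ! i"] \<open>i < length ws\<close> by simp
  with g \<open>i < length ws\<close> show ?thesis by simp
qed

text \<open>A trivial kernel makes the determinant nonzero, so \<open>A\<close> is a unit of the
  matrix ring, and \<open>mat_inverse\<close> returns \<open>None\<close> only for non-units. Thus
  \<open>the (mat_inverse A)\<close> is a genuine inverse.\<close>

lemma mat_inverse_trivial_kernel:
  fixes A :: "'a::field mat"
  assumes A: "A \<in> carrier_mat n n"
    and ker: "\<And>v. v \<in> carrier_vec n \<Longrightarrow> A *\<^sub>v v = 0\<^sub>v n \<Longrightarrow> v = 0\<^sub>v n"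
  obtains C where "mat_inverse A = Some C" "C \<in> carrier_mat n n" "A * C = 1\<^sub>m n" "C * A = 1\<^sub>m n"
proof -
  have "A \<in> Units (ring_mat TYPE('a) n ())"
    by (rule det_non_zero_imp_unit[OF A], subst det_0_iff_vec_prod_zero_field[OF A]) (use ker in blast)
  then obtain C where "mat_inverse A = Some C"
    using mat_inverse(1)[OF A, where b = "()"] by (cases "mat_inverse A") auto
  with mat_inverse(2)[OF A this] that show thesis by blast
qed

lemma invertible_mat_iff_trivial_kernel:
  fixes A :: "'a::field mat"
  assumes A: "A \<in> carrier_mat n n"
  shows "invertible_mat A \<longleftrightarrow> (\<forall>v\<in>carrier_vec n. A *\<^sub>v v = 0\<^sub>v n \<longrightarrow> v = 0\<^sub>v n)"
proof
  assume "invertible_mat A"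
  then obtain C where "A * C = 1\<^sub>m n" and CA: "C * A = 1\<^sub>m (dim_row C)"
    using A by (auto simp: invertible_mat_def inverts_mat_def)
  \<comment> \<open>\<open>invertible_mat\<close> leaves the size of the inverse open; the two
    products determine it.\<close>
  then have "dim_col C = n"
    by (metis index_mult_mat(3) index_one_mat(3))
  moreover have "dim_row C = n"
    using CA A by (metis carrier_matD(2) index_mult_mat(3) index_one_mat(3))
  ultimately have C: "C \<in> carrier_mat n n" by auto
  show "\<forall>v\<in>carrier_vec n. A *\<^sub>v v = 0\<^sub>v n \<longrightarrow> v = 0\<^sub>v n"
  proof (intro ballI impI)
    fix v assume v: "v \<in> carrier_vec n" and Av: "A *\<^sub>v v = 0\<^sub>v n"
    have "v = (C * A) *\<^sub>v v"
      using v CA C by simp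
    also have "\<dots> = C *\<^sub>v 0\<^sub>v n"
      using assoc_mult_mat_vec[OF C A v] Av by simp
    finally show "v = 0\<^sub>v n" using C by (auto simp: Matrix.vec_eq_iff)
  qed
next
  assume "\<forall>v\<in>carrier_vec n. A *\<^sub>v v = 0\<^sub>v n \<longrightarrow> v = 0\<^sub>v n"
  then obtain C where "C \<in> carrier_mat n n" "A * C = 1\<^sub>m n" "C * A = 1\<^sub>m n"
    using mat_inverse_trivial_kernel[OF A] by blast
  with A show "invertible_mat A"
    by (auto simp: invertible_mat_def inverts_mat_def)
qed

section \<open>Compressions \<open>W^T A W\<close>\<close>

lemma compress_carrier [simp]: "compress ws A \<in> carrier_mat (length ws) (length ws)"
  by (simp add: compress_def)

lemma compress_mult_vec_index:
  assumes "v \<in> carrier_vec (length ws)" "i < length ws"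
  shows "vec_index (compress ws A *\<^sub>v v) i
    = (ws ! i) \<bullet> (A *v (\<Sum>j<length ws. vec_index v j *\<^sub>R ws ! j))"
proof -
  have "A *v (\<Sum>j<length ws. vec_index v j *\<^sub>R ws ! j)
    = (\<Sum>j<length ws. vec_index v j *\<^sub>R (A *v ws ! j))"
    by (simp add: linear_sum[OF matrix_vector_mul_linear] matrix_vector_mult_scaleR o_def)
  then show ?thesis
    using assms
    by (auto simp: compress_def mult_mat_vec_def scalar_prod_def inner_sum_right mult.commute
        lessThan_atLeast0 intro!: sum.cong)
qed

lemma inner_span_eq_zero_iff:
  "(\<forall>z\<in>span S. z \<bullet> y = 0) \<longleftrightarrow> (\<forall>z\<in>S. z \<bullet> y = 0)"
  using span_induct[where S = S and P = "\<lambda>z. z \<bullet> y = 0"]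
  by (auto simp: subspace_def inner_left_distrib intro: span_base)

text \<open>The map \<open>v \<mapsto> W v\<close> is a bijection from coordinate vectors onto the
  range of \<open>W\<close>, and \<open>W^T A W v = 0\<close> says that \<open>A (W v)\<close> is
  orthogonal to that range.\<close>

lemma compress_kernel_trivial_iff:
  assumes "distinct ws" "independent (set ws)"
  shows "(\<forall>v\<in>carrier_vec (length ws). compress ws A *\<^sub>v v = 0\<^sub>v (length ws) \<longrightarrow> v = 0\<^sub>v (length ws))
    \<longleftrightarrow> (\<forall>u\<in>span (set ws). (\<forall>z\<in>span (set ws). z \<bullet> (A *v u) = 0) \<longrightarrow> u = 0)"
    (is "(\<forall>v\<in>?C. ?P v) \<longleftrightarrow> (\<forall>u\<in>?S. ?Q u)")
proof -
  let ?k = "length ws"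
  let ?f = "\<lambda>v. \<Sum>j<?k. vec_index v j *\<^sub>R ws ! j"
  have S: "?S = ?f ` ?C"
  proof (intro equalityI subsetI)
    fix x assume "x \<in> ?S"
    then obtain c where "x = (\<Sum>i<?k. c i *\<^sub>R ws ! i)"
      using span_set_nth[OF assms(1)] by auto
    then show "x \<in> ?f ` ?C"
      by (auto intro!: image_eqI[of _ _ "Matrix.vec ?k c"])
  qed (auto intro!: span_sum span_scale intro: span_base)
  have "?P v \<longleftrightarrow> ?Q (?f v)" if v: "v \<in> ?C" for v
  proof -
    have "compress ws A *\<^sub>v v = 0\<^sub>v ?k \<longleftrightarrow> (\<forall>i<?k. vec_index (compress ws A *\<^sub>v v) i = 0)"
      by (auto simp: Matrix.vec_eq_iff carrier_matD[OF compress_carrier] simp del: index_mult_mat_vec)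
    also have "\<dots> \<longleftrightarrow> (\<forall>z\<in>set ws. z \<bullet> (A *v ?f v) = 0)"
      by (simp add: compress_mult_vec_index[OF v] all_set_conv_all_nth)
    finally have 1: "compress ws A *\<^sub>v v = 0\<^sub>v ?k \<longleftrightarrow> (\<forall>z\<in>?S. z \<bullet> (A *v ?f v) = 0)"
      by (simp add: inner_span_eq_zero_iff)
    have "v = 0\<^sub>v ?k \<longleftrightarrow> ?f v = 0"
      using independent_nth_coeff_zero[OF assms, of "vec_index v"] v by auto
    with 1 show ?thesis by blast
  qed
  then show ?thesis unfolding S by blast
qed

text \<open>Only the span enters the criterion, so all bases of a subspace agree on invertibility.
  This turns the condition on \<open>Z\<close> into a property of the face alone.\<close>

lemma invertible_mat_compress_iff:
  assumes "distinct ws" "independent (set ws)"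
  shows "invertible_mat (compress ws A)
    \<longleftrightarrow> (\<forall>u\<in>span (set ws). (\<forall>z\<in>span (set ws). z \<bullet> (A *v u) = 0) \<longrightarrow> u = 0)"
  unfolding invertible_mat_iff_trivial_kernel[OF compress_carrier]
  by (rule compress_kernel_trivial_iff[OF assms])

section \<open>Expansions \<open>W C W^T\<close>\<close>

lemma expand_mult_vec:
  "expand ws C *v y
    = (\<Sum>i<length ws. (\<Sum>j<length ws. C $$ (i, j) * (ws ! j \<bullet> y)) *\<^sub>R ws ! i)"
proof (subst Finite_Cartesian_Product.vec_eq_iff, intro allI)
  fix p
  have "(expand ws C *v y) $ p
    = (\<Sum>q\<in>UNIV. \<Sum>i<length ws. \<Sum>j<length ws. (ws ! i) $ p * C $$ (i, j) * (ws ! j) $ q * y $ q)"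
    by (simp add: expand_def matrix_vector_mult_def sum_distrib_right)
  also have "\<dots>
    = (\<Sum>i<length ws. \<Sum>q\<in>UNIV. \<Sum>j<length ws. (ws ! i) $ p * C $$ (i, j) * (ws ! j) $ q * y $ q)"
    by (rule sum.swap)
  also have "\<dots>
    = (\<Sum>i<length ws. \<Sum>j<length ws. \<Sum>q\<in>UNIV. (ws ! i) $ p * C $$ (i, j) * (ws ! j) $ q * y $ q)"
    by (intro sum.cong refl sum.swap)
  also have "\<dots>
    = (\<Sum>i<length ws. (\<Sum>j<length ws. C $$ (i, j) * (ws ! j \<bullet> y)) *\<^sub>R ws ! i) $ p"
    by (simp add: inner_vec_def sum_distrib_left sum_distrib_right ac_simps)
  finally show "(expand ws C *v y) $ p
    = (\<Sum>i<length ws. (\<Sum>j<length ws. C $$ (i, j) * (ws ! j \<bullet> y)) *\<^sub>R ws ! i) $ p" .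
qed

lemma expand_mult_vec_in_span: "expand ws C *v y \<in> span (set ws)"
  unfolding expand_mult_vec by (auto intro!: span_sum span_scale intro: span_base)

lemma expand_mult_vec_eq_zero:
  assumes "\<forall>w\<in>span (set ws). w \<bullet> y = 0"
  shows "expand ws C *v y = 0"
  using assms unfolding expand_mult_vec inner_span_eq_zero_iff by simp

text \<open>This is \<open>W^T A E = W^T\<close> for \<open>E = W (W^T A W)^-1 W^T\<close>, tested
  against the range of \<open>W\<close>; \<open>inj\<close> guarantees that the inverse exists. In
  the proof \<open>b\<close> stands for \<open>W^T y\<close>.\<close>

lemma inner_mult_expand_mat_inverse_compress:
  assumes ws: "distinct ws" "independent (set ws)"
    and inj: "\<And>u. u \<in> span (set ws) \<Longrightarrow> \<forall>z\<in>span (set ws). z \<bullet> (A *v u) = 0 \<Longrightarrow> u = 0"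
    and w: "w \<in> span (set ws)"
  shows "w \<bullet> (A *v (expand ws (the (mat_inverse (compress ws A))) *v y)) = w \<bullet> y"
proof -
  let ?k = "length ws"
  obtain C where C: "mat_inverse (compress ws A) = Some C" "C \<in> carrier_mat ?k ?k"
      "compress ws A * C = 1\<^sub>m ?k"
    using mat_inverse_trivial_kernel[OF compress_carrier]
      compress_kernel_trivial_iff[OF ws, of A] inj by metis
  define b where "b = Matrix.vec ?k (\<lambda>j. ws ! j \<bullet> y)"
  have b: "b \<in> carrier_vec ?k" by (simp add: b_def)
  have Cb: "C *\<^sub>v b \<in> carrier_vec ?k" using C(2) b by simp
  have E: "expand ws C *v y = (\<Sum>i<?k. vec_index (C *\<^sub>v b) i *\<^sub>R ws ! i)"
    unfolding expand_mult_vec using C(2)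
    by (intro sum.cong refl) (auto simp: b_def scalar_prod_def lessThan_atLeast0)
  have "ws ! i \<bullet> (A *v (expand ws C *v y)) = ws ! i \<bullet> y" if i: "i < ?k" for i
  proof -
    have "ws ! i \<bullet> (A *v (expand ws C *v y)) = vec_index (compress ws A *\<^sub>v (C *\<^sub>v b)) i"
      by (simp only: compress_mult_vec_index[OF Cb i] E)
    also have "compress ws A *\<^sub>v (C *\<^sub>v b) = b"
      using assoc_mult_mat_vec[OF compress_carrier C(2) b, symmetric] C(3) b by simp
    finally show ?thesis using i by (simp add: b_def)
  qed
  then have "\<forall>z\<in>set ws. z \<bullet> (A *v (expand ws C *v y) - y) = 0"
    by (simp add: all_set_conv_all_nth inner_diff_right)
  then have "w \<bullet> (A *v (expand ws C *v y) - y) = 0"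
    using w inner_span_eq_zero_iff[of "set ws"] by blast
  then show ?thesis using C(1) by (simp add: inner_diff_right)
qed

section \<open>The kernel of \<open>- L + B^T E (B L - B)\<close>\<close>

lemma inner_transpose_mult_vec: "x \<bullet> (transpose A *v y) = (A *v x) \<bullet> (y :: real^'m)"
  for A :: "real^'n^'m"
  by (metis dot_lmul_matrix inner_commute transpose_matrix_vector)

lemma invertible_iff_trivial_kernel:
  fixes M :: "'a::field^'n^'n"
  shows "invertible M \<longleftrightarrow> (\<forall>u. M *v u = 0 \<longrightarrow> u = 0)"
  by (simp add: invertible_left_inverse matrix_left_invertible_ker)

lemma invertible_projected_iff:
  fixes B :: "real^'n^'s" and L :: "real^'n^'n"
  assumes ws: "distinct ws" "independent (set ws)"
    and inj: "\<And>w. w \<in> span (set ws) \<Longrightarrow> transpose B *v w = 0 \<Longrightarrow> w = 0"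
    and perp: "span (set ws) = (span A)\<^sup>\<bottom>"
  defines "V \<equiv> {u. B *v u \<in> span A}"
  shows "invertible (- L + transpose B **
            expand ws (the (mat_inverse (compress ws (B ** transpose B)))) ** (B ** L - B))
    \<longleftrightarrow> (\<forall>u\<in>V. (\<forall>z\<in>V. z \<bullet> (L *v u) = 0) \<longrightarrow> u = 0)"
    (is "invertible ?M \<longleftrightarrow> _")
proof -
  let ?E = "expand ws (the (mat_inverse (compress ws (B ** transpose B))))"
  have "(span A) = (span (set ws))\<^sup>\<bottom>"
    unfolding perp by (simp add: orthogonal_comp_self)
  then have V: "u \<in> V \<longleftrightarrow> (\<forall>w\<in>span (set ws). w \<bullet> (B *v u) = 0)" for u
    by (simp add: V_def orthogonal_comp_def orthogonal_def)
  have "w = 0" if "w \<in> span (set ws)" "\<forall>z\<in>span (set ws). z \<bullet> ((B ** transpose B) *v w) = 0" for w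
  proof -
    \<comment> \<open>The choice \<open>z = w\<close> produces the squared norm of
      \<open>transpose B *v w\<close>.\<close>
    have "w \<bullet> ((B ** transpose B) *v w) = 0" using that by blast
    then have "(transpose B *v w) \<bullet> (transpose B *v w) = 0"
      by (metis inner_transpose_mult_vec inner_commute matrix_vector_mul_assoc)
    with inj that(1) show ?thesis by simp
  qed
  then have E: "w \<bullet> (B *v (transpose B *v (?E *v y))) = w \<bullet> y" if "w \<in> span (set ws)" for w y
    using inner_mult_expand_mat_inverse_compress[OF ws _ that, of "B ** transpose B" y]
    by (simp add: matrix_vector_mul_assoc matrix_mul_assoc)
  have M: "?M *v u = transpose B *v (?E *v (B *v (L *v u) - B *v u)) - L *v u" for u
    by (simp add: matrix_vector_mult_add_rdistrib matrix_vector_mult_diff_rdistrib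
        matrix_vector_mul_assoc[symmetric])
  have test_range: "w \<bullet> (B *v (?M *v u)) = - (w \<bullet> (B *v u))" if "w \<in> span (set ws)" for w u
    by (simp only: M matrix_vector_mult_diff_distrib inner_diff_right E[OF that])
  have test_V: "z \<bullet> (?M *v u) = - (z \<bullet> (L *v u))" if "z \<in> V" for z u
  proof -
    \<comment> \<open>\<open>?E\<close> maps into the range of \<open>W\<close>, to which
      \<open>B *v z\<close> is orthogonal for \<open>z \<in> V\<close>.\<close>
    have "(B *v z) \<bullet> (?E *v y) = 0" for y
      using that expand_mult_vec_in_span unfolding V by (metis inner_commute)
    then show ?thesis
      unfolding M inner_diff_right inner_transpose_mult_vec by simp
  qed
  have "?M *v u = 0 \<longleftrightarrow> u \<in> V \<and> (\<forall>z\<in>V. z \<bullet> (L *v u) = 0)" for u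
  proof
    assume 0: "?M *v u = 0"
    have "u \<in> V" unfolding V using test_range[of _ u] 0 by simp
    moreover have "\<forall>z\<in>V. z \<bullet> (L *v u) = 0" using test_V[of _ u] 0 by simp
    ultimately show "u \<in> V \<and> (\<forall>z\<in>V. z \<bullet> (L *v u) = 0)" by blast
  next
    assume u: "u \<in> V \<and> (\<forall>z\<in>V. z \<bullet> (L *v u) = 0)"
    \<comment> \<open>\<open>?M *v u\<close> lies in \<open>V\<close> and is orthogonal to all of
      \<open>V\<close>, hence to itself.\<close>
    have "?M *v u \<in> V" using u test_range[of _ u] unfolding V by simp
    then have "(?M *v u) \<bullet> (?M *v u) = 0" using u test_V[of _ u] by simp
    then show "?M *v u = 0" by simp
  qed
  then show ?thesis unfolding invertible_iff_trivial_kernel by blast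
qed

section \<open>Normal cones and faces of the critical cone\<close>

lemma normal_cone_monotone:
  fixes d d' l l' :: "'a::euclidean_space"
  assumes "l \<in> normal_cone D d" "l' \<in> normal_cone D d'"
  shows "0 \<le> (l - l') \<bullet> (d - d')"
proof -
  have "l \<bullet> (d' - d) \<le> 0" "l' \<bullet> (d - d') \<le> 0"
    using assms by (auto simp: normal_cone_def)
  then show ?thesis by (simp add: inner_diff_left inner_diff_right)
qed

text \<open>A point outside the closed convex tangent cone can be strictly separated from it, and
  the negated separating functional is a normal vector.\<close>

lemma orthogonal_comp_span_normal_cone_subset_tangent_cone:
  fixes d :: "'a::euclidean_space"
  assumes "convex D" "d \<in> D"
  shows "(span (normal_cone D d))\<^sup>\<bottom> \<subseteq> tangent_cone D d"
proof
  fix y assume y: "y \<in> (span (normal_cone D d))\<^sup>\<bottom>"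
  let ?H = "conic hull ((\<lambda>y. y - d) ` D)"
  show "y \<in> tangent_cone D d"
  proof (rule ccontr)
    assume "y \<notin> tangent_cone D d"
    moreover have "convex (closure ?H)"
      using assms by (intro convex_closure convex_conic_hull convex_translation_subtract)
    ultimately obtain a b where ay: "a \<bullet> y < b" and ab: "\<forall>x\<in>closure ?H. b < a \<bullet> x"
      using separating_hyperplane_closed_point[of "closure ?H" y] assms
      by (auto simp: tangent_cone_def)
    have H: "b < t * (a \<bullet> (x - d))" if "x \<in> D" "0 \<le> t" for x t
    proof -
      have "t *\<^sub>R (x - d) \<in> ?H"
        using that by (auto simp: conic_hull_explicit)
      with ab closure_subset show ?thesis by fastforce
    qed
    have "b < 0" using H[OF assms(2), of 0] by simp
    have "0 \<le> a \<bullet> (x - d)" if "x \<in> D" for x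
    proof (rule ccontr)
      assume "\<not> 0 \<le> a \<bullet> (x - d)"
      \<comment> \<open>This positive scaling factor turns the strict bound into
        \<open>b < b\<close>.\<close>
      with H[OF that, of "b / (a \<bullet> (x - d))"] \<open>b < 0\<close> show False
        by (simp add: divide_nonpos_neg)
    qed
    then have "- a \<in> normal_cone D d"
      using assms by (simp add: normal_cone_def)
    then have "- a \<bullet> y = 0"
      using y span_base unfolding orthogonal_comp_def orthogonal_def by blast
    with ay \<open>b < 0\<close> show False by simp
  qed
qed

text \<open>The lineality space of a cone is contained in each of its faces; for the critical cone it
  contains the orthogonal complement of the normal cone.\<close>

lemma orthogonal_comp_face_subset_span_normal_cone:
  fixes d l :: "'a::euclidean_space"
  assumes "convex D" "l \<in> normal_cone D d" "cone_face A (critical_cone D d l)"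
  shows "(span A)\<^sup>\<bottom> \<subseteq> span (normal_cone D d)"
proof -
  let ?N = "span (normal_cone D d)"
  have d: "d \<in> D" using assms(2) by (simp add: normal_cone_def)
  obtain v where v: "v \<in> polar_cone (critical_cone D d l)"
    and A: "A = critical_cone D d l \<inter> {v}\<^sup>\<bottom>"
    using assms(3) by (auto simp: cone_face_def)
  have K: "?N\<^sup>\<bottom> \<subseteq> critical_cone D d l"
    using orthogonal_comp_span_normal_cone_subset_tangent_cone[OF assms(1) d] assms(2)
      orthogonal_comp_anti_mono[of "{l}" ?N]
    by (auto simp: critical_cone_def intro: span_base)
  have "?N\<^sup>\<bottom> \<subseteq> A"
  proof
    fix y assume y: "y \<in> ?N\<^sup>\<bottom>"
    \<comment> \<open>Since \<open>y\<close> and \<open>- y\<close> both lie in the critical cone,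
      \<open>v\<close>, which is nonpositive there, vanishes at \<open>y\<close>.\<close>
    then have "- y \<in> ?N\<^sup>\<bottom>" using subspace_orthogonal_comp subspace_neg by blast
    with y K v have "v \<bullet> y \<le> 0" "v \<bullet> (- y) \<le> 0"
      unfolding polar_cone_def by blast+
    then have "y \<in> {v}\<^sup>\<bottom>" by (simp add: orthogonal_comp_def orthogonal_def)
    with y K A show "y \<in> A" by blast
  qed
  then have "(span A)\<^sup>\<bottom> \<subseteq> (?N\<^sup>\<bottom>)\<^sup>\<bottom>"
    by (intro orthogonal_comp_anti_mono) (use span_superset in blast)
  then show ?thesis by (simp add: orthogonal_comp_self)
qed

section \<open>The solution and multiplier maps at a solution\<close>

lemma nondegenerate_injective:
  assumes "nondegenerate G D x d \<gamma>" "l \<in> span (normal_cone D d)" "nabla G x *v l = 0"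
  shows "l = 0"
proof -
  have "0 < \<gamma>" "\<gamma> * norm l \<le> norm (nabla G x *v l)"
    using assms(1,2) by (simp_all add: nondegenerate_def)
  with assms(3) show ?thesis
    by (simp add: mult_le_0_iff)
qed

text \<open>If \<open>u\<close> solves the subproblem with multiplier \<open>m\<close>, subtracting
  the two equations gives \<open>nabla G x *v (m - l) = - u\<close>, and monotonicity then yields
  \<open>0 \<le> - (u \<bullet> u)\<close>.\<close>

lemma S_map_eq_zero:
  assumes "l \<in> normal_cone D (G x)" "Lagr F G l x = 0"
  shows "S_map F G D x = 0"
  unfolding S_map_def
proof (rule the_equality)
  show "0 \<in> (\<lambda>l. 0 + F x + nabla G x *v l) ` normal_cone D (G x + Jac G x *v 0)"
    using assms by (auto simp: Lagr_def intro!: image_eqI[of _ _ l])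
next
  fix u assume "0 \<in> (\<lambda>l. u + F x + nabla G x *v l) ` normal_cone D (G x + Jac G x *v u)"
  then obtain m where m: "m \<in> normal_cone D (G x + Jac G x *v u)" "u + F x + nabla G x *v m = 0"
    by auto
  have "0 \<le> (m - l) \<bullet> (Jac G x *v u)"
    using normal_cone_monotone[OF m(1) assms(1)] by simp
  also have "\<dots> = u \<bullet> (nabla G x *v m - nabla G x *v l)"
    by (metis inner_commute inner_transpose_mult_vec matrix_vector_mult_diff_distrib)
  also have "nabla G x *v m - nabla G x *v l = - u"
  proof -
    have "nabla G x *v m - nabla G x *v l + u = (u + F x + nabla G x *v m) - (F x + nabla G x *v l)"
      by simp
    also have "\<dots> = 0"
      using m(2) assms(2) by (simp add: Lagr_def)
    finally show ?thesis by (simp only: add_eq_0_iff2)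
  qed
  finally show "u = 0"
    using inner_gt_zero_iff[of u] by (simp add: not_less[symmetric])
qed

text \<open>Two multipliers differ by an element of the span of the normal cone that
  \<open>nabla G x\<close> annihilates; nondegeneracy makes it zero.\<close>

lemma Lambda_map_eq:
  assumes "nondegenerate G D x (G x) \<gamma>"
    and l: "l \<in> normal_cone D (G x)" "Lagr F G l x = 0"
  shows "Lambda_map F G D x = l"
  unfolding Lambda_map_def S_map_eq_zero[OF l]
proof (rule the_equality)
  show "l \<in> normal_cone D (G x + Jac G x *v 0) \<and> 0 + F x + nabla G x *v l = 0"
    using l by (simp add: Lagr_def)
next
  fix m assume m: "m \<in> normal_cone D (G x + Jac G x *v 0) \<and> 0 + F x + nabla G x *v m = 0"
  have "nabla G x *v m = nabla G x *v l"
    using m l(2) unfolding Lagr_def by (metis add_0 add_left_cancel)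
  then have "nabla G x *v (m - l) = 0" by (simp add: matrix_vector_mult_diff_distrib)
  moreover have "m - l \<in> span (normal_cone D (G x))"
    using m l(1) by (simp add: span_base span_diff)
  ultimately show "m = l" using nondegenerate_injective[OF assms(1)] by fastforce
qed

theorem proposition4p3:
  fixes F :: "real^'n \<Rightarrow> real^'n"
    and G :: "real^'n \<Rightarrow> real^'s"
    and D :: "(real^'s) set"
    and xbar :: "real^'n"
    and lbar :: "real^'s"
    and \<gamma> :: real
  assumes "cont_diff F"
    and "twice_cont_diff G"
    and "polyhedron D"
    and "0 \<in> (\<lambda>l. F xbar + nabla G xbar *v l) ` normal_cone D (G xbar)"
    and "\<gamma> > 0"
    and "nondegenerate G D xbar (G xbar) \<gamma>"
    and "lbar \<in> normal_cone D (G xbar)"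
    and "Lagr F G lbar xbar = 0"
  shows "(\<forall>A. cone_face A (critical_cone D (G xbar) lbar) \<longrightarrow>
            (\<exists>zs. orthogonal_basis zs {u. Jac G xbar *v u \<in> span A} \<and>
                  invertible_mat (compress zs (Jac (Lagr F G lbar) xbar))))
     \<longleftrightarrow> (\<forall>M \<in> T_S F G D xbar. invertible M)"
proof -
  let ?B = "Jac G xbar" and ?L = "Jac (Lagr F G lbar) xbar"
  let ?K = "critical_cone D (G xbar) lbar"
  define V where "V A = {u. ?B *v u \<in> span A}" for A
  define nondeg where "nondeg A \<longleftrightarrow> (\<forall>u\<in>V A. (\<forall>z\<in>V A. z \<bullet> (?L *v u) = 0) \<longrightarrow> u = 0)" for A
  define M where "M ws = - ?L + nabla G xbar **
      expand ws (the (mat_inverse (compress ws (?B ** nabla G xbar)))) ** (?B ** ?L - ?B)" for ws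
  \<comment> \<open>At \<open>u = 0\<close> the Jacobian of
    \<open>\<lambda>y. G y + Jac G y *v u\<close> reduces to \<open>?B\<close>.\<close>
  have T_S: "T_S F G D xbar = {M ws | ws. full_column_rank ws \<and>
      (\<exists>A. cone_face A ?K \<and> span (set ws) = (span A)\<^sup>\<bottom>)}"
    using S_map_eq_zero[OF assms(7,8)] Lambda_map_eq[OF assms(6-8)]
    by (simp add: T_S_def M_def Let_def)
  have M: "invertible (M ws) \<longleftrightarrow> nondeg A"
    if "cone_face A ?K" "full_column_rank ws" "span (set ws) = (span A)\<^sup>\<bottom>" for A ws
    unfolding M_def nondeg_def V_def
  proof (rule invertible_projected_iff)
    fix w assume "w \<in> span (set ws)" "nabla G xbar *v w = 0"
    \<comment> \<open>Nondegeneracy controls \<open>nabla G xbar\<close> only on the span of the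
      normal cone, so the range of \<open>W\<close> has to lie there.\<close>
    moreover have "(span A)\<^sup>\<bottom> \<subseteq> span (normal_cone D (G xbar))"
      using orthogonal_comp_face_subset_span_normal_cone that(1) assms(3,7)
        polyhedron_imp_convex by blast
    ultimately show "w = 0"
      using nondegenerate_injective[OF assms(6)] that(3) by blast
  qed (use that in \<open>auto simp: full_column_rank_def\<close>)
  have Z: "invertible_mat (compress zs ?L) \<longleftrightarrow> nondeg A" if "orthogonal_basis zs (V A)" for A zs
    using that invertible_mat_compress_iff[of zs ?L]
    by (auto simp: orthogonal_basis_def nondeg_def)
  have ex_Z: "\<exists>zs. orthogonal_basis zs (V A)" for A
  proof -
    have "subspace (V A)"
      unfolding V_def
      using linear_subspace_vimage[OF matrix_vector_mul_linear subspace_span, of ?B A]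
      by (simp add: vimage_def)
    then obtain Z where "pairwise orthogonal Z" "independent Z" "span Z = V A"
      by (rule orthogonal_basis_subspace)
    moreover obtain zs where "set zs = Z" "distinct zs"
      using finite_distinct_list independent_imp_finite[OF calculation(2)] by blast
    ultimately show ?thesis by (auto simp: orthogonal_basis_def)
  qed
  \<comment> \<open>Every face must contribute an element to \<open>T_S\<close>; otherwise
    invertibility on \<open>T_S\<close> would say nothing about that face.\<close>
  have ex_W: "\<exists>ws. full_column_rank ws \<and> span (set ws) = (span A)\<^sup>\<bottom>" for A :: "(real^'s) set"
  proof -
    obtain W where "independent W" "span W = (span A)\<^sup>\<bottom>"
      by (rule orthogonal_basis_subspace[OF subspace_orthogonal_comp])
    moreover obtain ws where "set ws = W" "distinct ws"
      using finite_distinct_list independent_imp_finite[OF calculation(1)] by blast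
    ultimately show ?thesis by (auto simp: full_column_rank_def)
  qed
  \<comment> \<open>By \<open>Z\<close> every orthogonal basis gives the same verdict, and
    \<open>ex_Z\<close> provides one.\<close>
  have "(\<forall>A. cone_face A ?K \<longrightarrow>
      (\<exists>zs. orthogonal_basis zs (V A) \<and> invertible_mat (compress zs ?L)))
    \<longleftrightarrow> (\<forall>A. cone_face A ?K \<longrightarrow> nondeg A)"
    using Z ex_Z by metis
  also have "\<dots> \<longleftrightarrow> (\<forall>M \<in> T_S F G D xbar. invertible M)"
  proof
    assume "\<forall>A. cone_face A ?K \<longrightarrow> nondeg A"
    then show "\<forall>M \<in> T_S F G D xbar. invertible M"
      unfolding T_S using M by auto
  next
    assume inv: "\<forall>M \<in> T_S F G D xbar. invertible M"
    show "\<forall>A. cone_face A ?K \<longrightarrow> nondeg A"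
    proof (intro allI impI)
      fix A assume A: "cone_face A ?K"
      obtain ws where ws: "full_column_rank ws" "span (set ws) = (span A)\<^sup>\<bottom>"
        using ex_W by blast
      then have "M ws \<in> T_S F G D xbar" unfolding T_S using A by blast
      with inv M[OF A ws] show "nondeg A" by blast
    qed
  qed
  finally show ?thesis unfolding V_def .
qed

end
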